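(* Let $n\geq 2$. Then: (1) The number of primitive G-words on $[n]=\{1,\dots,n\}$ equals the number of decreasing 012-trees on vertex set $[n-2]$. (2) The number of primitive R-words on $[n]$ equals the number of decreasing 012-trees on vertex set $[n-2]$.
   Context: For a finite set $P$ of positive integers with $|P|=n$, a permutation $w$ of $P$ is written as a word $w=w_1w_2\cdots w_n$ with $\{w_1,\dots,w_n\}=P$. The reversal of $w$ is $w^*=w_nw_{n-1}\cdots w_1$. A subword of $w$ is a contiguous word $w[i,j]=w_iw_{i+1}\cdots w_j$ with $1\le i\le j\le n$; it is proper if $w[i,j]\neq w$. Let $|P|=n\geq 2$. A permutation $w$ of $P$ is a G-word if (G1) $w_1=\max(P)$ and $w_n=\max(P\setminus\{w_1\})$, and (G2) if $n\geq 4$ then $w_2>w_{n-1}$. It is an R-word if (R1) $w_1=\max(P)$ and $w_n=\max(P\setminus\{w_1\})$, and (R2) if $n\geq 4$ then $w_2<w_{n-1}$. A G-word (resp. R-word) $w$ is primitive if for every proper subword $x$ of $w$ of length at least $4$, neither $x$ nor $x^*$ is a G-word (resp. R-word). A decreasing 012-tree on vertex set $P$ is a rooted tree whose vertices are labeled by the distinct elements of $P$, such that every vertex has $0$, $1$ or $2$ children (children unordered), and $x<y$ whenever $x$ is a descendant of $y$. By convention, for $P=\emptyset$ there is exactly one (empty) decreasing 012-tree. *)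

theory Defs
  imports
    "HOL-Combinatorics.Multiset_Permutations"
    "HOL-Library.Sublist"
begin

text \<open>
  A word \<open>w\<^sub>1 \<dots> w\<^sub>n\<close> is a list, so \<open>w\<^sub>i\<close> is \<open>w ! (i - 1)\<close>; in particular
  \<open>w\<^sub>2\<close> is \<open>w ! 1\<close> and \<open>w\<^bsub>n-1\<^esub>\<close> is \<open>w ! (n - 2)\<close>.
  The reversal \<open>w\<^sup>*\<close> is \<^term>\<open>rev w\<close>.
\<close>

definition perm_word :: "nat set \<Rightarrow> nat list \<Rightarrow> bool" where
  "perm_word P w \<longleftrightarrow> finite P \<and> 0 \<notin> P \<and> w \<in> permutations_of_set P"

definition G_word :: "nat set \<Rightarrow> nat list \<Rightarrow> bool" where
  "G_word P w \<longleftrightarrow> perm_word P w \<and> card P \<ge> 2 \<and>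
     hd w = Max P \<and> last w = Max (P - {hd w}) \<and>
     (card P \<ge> 4 \<longrightarrow> w ! 1 > w ! (card P - 2))"

definition R_word :: "nat set \<Rightarrow> nat list \<Rightarrow> bool" where
  "R_word P w \<longleftrightarrow> perm_word P w \<and> card P \<ge> 2 \<and>
     hd w = Max P \<and> last w = Max (P - {hd w}) \<and>
     (card P \<ge> 4 \<longrightarrow> w ! 1 < w ! (card P - 2))"

text \<open>
  \<^const>\<open>strict_sublist\<close> is the proper contiguous sublist relation. It also admits the
  empty list, which the length condition excludes.
\<close>

definition primitive_G_word :: "nat set \<Rightarrow> nat list \<Rightarrow> bool" where
  "primitive_G_word P w \<longleftrightarrow> G_word P w \<and>
     (\<forall>x. strict_sublist x w \<and> length x \<ge> 4 \<longrightarrow>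
        \<not> G_word (set x) x \<and> \<not> G_word (set x) (rev x))"

definition primitive_R_word :: "nat set \<Rightarrow> nat list \<Rightarrow> bool" where
  "primitive_R_word P w \<longleftrightarrow> R_word P w \<and>
     (\<forall>x. strict_sublist x w \<and> length x \<ge> 4 \<longrightarrow>
        \<not> R_word (set x) x \<and> \<not> R_word (set x) (rev x))"

text \<open>
  A rooted tree on the vertex set \<open>V\<close> is encoded by its set \<open>E\<close> of (child, parent) pairs.
  The root is the only vertex without a parent, so \<open>V\<close> and \<open>E\<close> determine the rooted tree,
  and distinct rooted trees on \<open>V\<close> have distinct edge sets. Children are unordered, and
  \<open>x\<close> is a (proper) descendant of \<open>y\<close> iff \<open>(x, y) \<in> E\<^sup>+\<close>.
\<close>

definition rooted_tree :: "'a set \<Rightarrow> ('a \<times> 'a) set \<Rightarrow> bool" where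
  "rooted_tree V E \<longleftrightarrow> E \<subseteq> V \<times> V \<and>
     (\<exists>r\<in>V. (\<nexists>y. (r, y) \<in> E) \<and>
            (\<forall>x\<in>V - {r}. \<exists>!y. (x, y) \<in> E) \<and>
            (\<forall>x\<in>V. (x, r) \<in> E\<^sup>*))"

text \<open>
  The first disjunct is the convention that there is exactly one tree on the empty
  vertex set. Finiteness of the set of children is stated because \<^const>\<open>card\<close> is \<open>0\<close>
  on infinite sets.
\<close>

definition decreasing_012_tree :: "nat set \<Rightarrow> (nat \<times> nat) set \<Rightarrow> bool" where
  "decreasing_012_tree P E \<longleftrightarrow>
     P = {} \<and> E = {} \<or>
     rooted_tree P E \<and>
     (\<forall>y\<in>P. finite {x. (x, y) \<in> E} \<and> card {x. (x, y) \<in> E} \<le> 2) \<and>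
     (\<forall>x y. (x, y) \<in> E\<^sup>+ \<longrightarrow> x < y)"

end

theory Submission
  imports Defs
begin

text \<open>
  Write \<open>w = n u (n-1)\<close>. A subword of \<open>w\<close> whose two end letters exceed all inner letters is
  determined by the largest inner letter \<open>m\<close>: it is the maximal run of letters \<open>\<le> m\<close> around \<open>m\<close>
  together with the two adjacent letters. So primitivity can be checked recursively: if
  \<open>u = L m R\<close> with \<open>m\<close> maximal, then it is a condition on \<open>L\<close>, the same condition on the reversal
  \<open>R\<^sup>*\<close> (in \<open>m R (n-1)\<close> the larger end letter is on the right), and a comparison of the first
  and last letters of \<open>u\<close>, that is, of the first letters of \<open>L m\<close> and \<open>R\<^sup>* m\<close>. Of the two words
  \<open>X m Y\<^sup>*\<close> and \<open>Y m X\<^sup>*\<close> exactly one satisfies this comparison, in whichever direction it is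
  required, so such words correspond to unordered pairs \<open>{X, Y}\<close>. Deleting the root of a
  decreasing 012-tree gives an unordered pair of such trees, so both families satisfy the same
  recurrence. Unordered pairs are counted by letting the first part contain the maximum of what is
  left after deleting \<open>m\<close>.
\<close>

section \<open>Subwords with dominating end letters\<close>

text \<open>For distinct positive letters: \<open>a # u @ [b]\<close> or its reversal is a G-word
  (\<open>c\<close> is \<open>>\<close>) or an R-word (\<open>c\<close> is \<open><\<close>) of
  length at least 4. If \<open>a < b\<close>, the word is read backwards, which swaps
  \<open>hd u\<close> and \<open>last u\<close>.\<close>

definition framed :: "(nat \<Rightarrow> nat \<Rightarrow> bool) \<Rightarrow> nat \<Rightarrow> nat list \<Rightarrow> nat \<Rightarrow> bool" where
  "framed c a u b \<longleftrightarrow> 2 \<le> length u \<and> (\<forall>x\<in>set u. x < a \<and> x < b) \<and>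
     (if b < a then c (hd u) (last u) else c (last u) (hd u))"

text \<open>\<open>w\<close> itself counts as a subword, since the two halves of a primitive word
  are proper subwords in their own right.\<close>

definition avoids :: "(nat \<Rightarrow> nat \<Rightarrow> bool) \<Rightarrow> nat list \<Rightarrow> bool" where
  "avoids c w \<longleftrightarrow> (\<forall>a u b. sublist (a # u @ [b]) w \<longrightarrow> \<not> framed c a u b)"

text \<open>Covers \<open>>\<close> and \<open><\<close> at once and is preserved by taking the
  converse.\<close>

definition tournament :: "('a \<Rightarrow> 'a \<Rightarrow> bool) \<Rightarrow> bool" where
  "tournament c \<longleftrightarrow> (\<forall>x y. x \<noteq> y \<longrightarrow> c x y \<longleftrightarrow> \<not> c y x)"

lemma tournamentD: "tournament c \<Longrightarrow> x \<noteq> y \<Longrightarrow> c x y \<longleftrightarrow> \<not> c y x"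
  unfolding tournament_def by blast

text \<open>The part to the right of the maximum is read backwards, so that both parts obey one rule.\<close>

inductive good :: "(nat \<Rightarrow> nat \<Rightarrow> bool) \<Rightarrow> nat list \<Rightarrow> bool" for c where
  Nil: "good c []"
| split: "good c L \<Longrightarrow> good c R \<Longrightarrow> \<forall>x\<in>set L \<union> set R. x < m \<Longrightarrow>
    (2 \<le> length (L @ m # rev R) \<longrightarrow> c (hd (L @ m # rev R)) (last (L @ m # rev R))) \<Longrightarrow>
    good c (L @ m # rev R)"

definition rooted :: "(nat \<Rightarrow> nat \<Rightarrow> bool) \<Rightarrow> (nat \<Rightarrow> nat \<Rightarrow> bool) \<Rightarrow> nat list \<Rightarrow> bool" where
  "rooted d c u \<longleftrightarrow> u = [] \<or> (\<exists>L m R. u = L @ m # rev R \<and> good c L \<and> good c R \<and>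
     (\<forall>x\<in>set L \<union> set R. x < m) \<and> (2 \<le> length u \<longrightarrow> d (hd u) (last u)))"

lemma good_iff_rooted: "good c u \<longleftrightarrow> rooted c c u"
  unfolding rooted_def by (subst good.simps) blast

section \<open>Splitting a word at its maximum\<close>

lemma decompose_at_Max:
  fixes u :: "'a::linorder list"
  assumes "distinct u" "u \<noteq> []"
  obtains L m R where "u = L @ m # rev R" "m = Max (set u)" "\<forall>x\<in>set L \<union> set R. x < m"
proof -
  have "Max (set u) \<in> set u" using assms by simp
  then obtain L R where u: "u = L @ Max (set u) # R" by (meson split_list)
  have "\<forall>x\<in>set L \<union> set R. x < Max (set u)"
  proof
    fix x assume x: "x \<in> set L \<union> set R"
    from u assms(1) have "Max (set u) \<notin> set L \<union> set R"
      by (metis Un_iff distinct.simps(2) distinct_append disjoint_iff list.set_intros(1))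
    moreover from x u have "x \<in> set u" by (metis Un_iff list.set_intros(2) set_append)
    ultimately show "x < Max (set u)" using x by (metis List.finite_set Max_ge le_neq_trans)
  qed
  then show ?thesis using that[of L "Max (set u)" "rev R"] u by simp
qed

text \<open>Both \<open>m\<close> and \<open>m'\<close> are the maximum of the same set of letters,
  and this letter occurs only once on each side.\<close>

lemma decompose_unique:
  fixes m m' :: "'a::linorder"
  assumes "L @ m # R = L' @ m' # R'"
    and "\<forall>x\<in>set L \<union> set R. x < m" "\<forall>x\<in>set L' \<union> set R'. x < m'"
  shows "L = L' \<and> m = m' \<and> R = R'"
proof -
  have "set L \<union> {m} \<union> set R = set L' \<union> {m'} \<union> set R'"
    using arg_cong[OF assms(1), of set] by auto
  then have "m \<in> set L' \<union> {m'} \<union> set R'" "m' \<in> set L \<union> {m} \<union> set R" by auto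
  then have "m \<le> m'" "m' \<le> m" using assms(2,3) by (fastforce intro: less_imp_le)+
  then have m: "m = m'" by simp
  moreover have "m \<notin> set L" "m \<notin> set L'" "m \<notin> set R" "m \<notin> set R'"
    using assms(2,3) m by auto
  ultimately show ?thesis using assms(1)
    by (auto simp: append_Cons_eq_iff)
qed

text \<open>Consider where \<open>m\<close> falls. If it is not in \<open>u\<close>, the subword
  stays within one half. If it is, then \<open>a'\<close> and \<open>b'\<close> exceed
  \<open>m\<close>, which only \<open>a\<close> and \<open>b\<close> can do, so the subword is the
  whole word.\<close>

lemma sublist_dominated_cases:
  fixes m :: "'a::linorder"
  assumes dist: "distinct (a # L @ m # R @ [b])"
    and lt: "\<forall>x\<in>set L \<union> set R. x < m"
    and sub: "sublist (a' # u @ [b']) (a # L @ m # R @ [b])"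
    and dom: "\<forall>x\<in>set u. x < a' \<and> x < b'"
  shows "(a' = a \<and> u = L @ m # R \<and> b' = b) \<or> sublist (a' # u @ [b']) (a # L @ [m]) \<or>
    sublist (a' # u @ [b']) (m # R @ [b])"
proof -
  obtain ps ss where eq: "(a # L) @ m # (R @ [b]) = ps @ (a' # u @ [b']) @ ss"
    using sub by (auto simp: sublist_def)
  have nin: "m \<notin> set (a # L)" "m \<notin> set (R @ [b])" using dist by auto
  have "m \<in> set (ps @ (a' # u @ [b']) @ ss)" unfolding eq[symmetric] by simp
  then consider "m \<in> set ps" | "m = a'" | "m \<in> set u" | "m = b'" | "m \<in> set ss" by auto
  then show ?thesis
  proof cases
    case 1
    then obtain p q where "ps = p @ m # q" by (meson split_list)
    then have "R @ [b] = q @ (a' # u @ [b']) @ ss"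
      using eq nin append_Cons_eq_iff[of m "a # L" "R @ [b]" p "q @ (a' # u @ [b']) @ ss"]
      by simp
    then have "m # R @ [b] = (m # q) @ (a' # u @ [b']) @ ss" by simp
    then show ?thesis unfolding sublist_def by blast
  next
    case 2
    then have "R @ [b] = u @ [b'] @ ss"
      using eq nin append_Cons_eq_iff[of m "a # L" "R @ [b]" ps "u @ [b'] @ ss"] by simp
    then have "m # R @ [b] = [] @ (a' # u @ [b']) @ ss" using 2 by simp
    then show ?thesis unfolding sublist_def by blast
  next
    case 3
    have dist': "distinct (ps @ (a' # u @ [b']) @ ss)"
      unfolding eq[symmetric] using dist by simp
    have sets: "insert a (insert b (insert m (set L \<union> set R))) =
        set ps \<union> {a', b'} \<union> set u \<union> set ss"
      using arg_cong[OF eq, of set] by auto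
    have "a' > m" "b' > m" using dom 3 by auto
    moreover have "{a', b'} \<subseteq> insert a (insert b (insert m (set L \<union> set R)))"
      unfolding sets by blast
    moreover have "\<forall>x\<in>insert m (set L \<union> set R). \<not> m < x" using lt by (auto dest: less_asym)
    ultimately have ab: "a' \<in> {a, b}" "b' \<in> {a, b}" by auto
    \<comment> \<open>The distinct letters \<open>a'\<close> and \<open>b'\<close> use up
      \<open>{a, b}\<close>, so a nonempty \<open>ps\<close> would begin with a second
      \<open>a\<close>.\<close>
    have "ps = []"
    proof (rule ccontr)
      assume "ps \<noteq> []"
      then obtain ps' where "ps = a # ps'" using eq by (cases ps) auto
      then show False using ab dist' by auto
    qed
    moreover have "ss = []"
    proof (rule ccontr)
      assume "ss \<noteq> []"
      then obtain s ss' where ss: "ss = ss' @ [s]" by (metis rev_exhaust)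
      have "last ((a # L) @ m # (R @ [b])) = last (ps @ (a' # u @ [b']) @ ss)"
        using eq by simp
      then have "s = b" using ss by simp
      then show False using ab dist' ss by auto
    qed
    ultimately have "a # (L @ m # R) @ [b] = a' # u @ [b']" using eq by simp
    then show ?thesis by (metis append1_eq_conv list.inject)
  next
    case 4
    then have "a # L = ps @ a' # u"
      using eq nin append_Cons_eq_iff[of m "a # L" "R @ [b]" "ps @ a' # u" ss] by simp
    then have "a # L @ [m] = ps @ (a' # u @ [b']) @ []" using 4
      by (metis append.assoc append_Cons append_Nil2)
    then show ?thesis unfolding sublist_def by blast
  next
    case 5
    then obtain p q where "ss = p @ m # q" by (meson split_list)
    then have "a # L = ps @ (a' # u @ [b']) @ p"
      using eq nin append_Cons_eq_iff[of m "a # L" "R @ [b]" "ps @ (a' # u @ [b']) @ p" q]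
      by simp
    then have "a # L @ [m] = ps @ (a' # u @ [b']) @ (p @ [m])"
      by (metis append.assoc append_Cons)
    then show ?thesis unfolding sublist_def by blast
  qed
qed

section \<open>Framed subwords under reversal and splitting\<close>

lemma framed_rev:
  "distinct (a # u @ [b]) \<Longrightarrow> framed c b (rev u) a \<longleftrightarrow> framed c a u b"
  by (cases "u = []") (auto simp: framed_def hd_rev last_rev)

lemma avoids_revI:
  assumes "distinct w" "avoids c w"
  shows "avoids c (rev w)"
  unfolding avoids_def
proof (intro allI impI)
  fix a u b
  assume "sublist (a # u @ [b]) (rev w)"
  then have "sublist (rev (a # u @ [b])) w" by (simp only: sublist_rev_left)
  then have s: "sublist (b # rev u @ [a]) w" by simp
  then have "distinct (b # rev u @ [a])" using assms(1) by (auto simp: sublist_def)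
  then show "\<not> framed c a u b" using s assms(2) framed_rev[of b "rev u" a c]
    unfolding avoids_def by auto
qed

lemma avoids_rev: "distinct w \<Longrightarrow> avoids c (rev w) \<longleftrightarrow> avoids c w"
  using avoids_revI[of w c] avoids_revI[of "rev w" c] by auto

text \<open>By \<open>sublist_dominated_cases\<close> a framed proper subword lies in one of two
  halves that overlap in \<open>m\<close>. Each half misses an end letter, so all its subwords are
  proper.\<close>

lemma no_strict_framed_iff:
  assumes dist: "distinct (a # L @ m # R @ [b])"
    and lt: "\<forall>x\<in>set L \<union> set R. x < m"
  shows "(\<forall>a' u b'. strict_sublist (a' # u @ [b']) (a # L @ m # R @ [b]) \<longrightarrow> \<not> framed c a' u b')
    \<longleftrightarrow> avoids c (a # L @ [m]) \<and> avoids c (m # R @ [b])" (is "?lhs \<longleftrightarrow> ?rhs")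
proof
  assume ?lhs
  have "strict_sublist x (a # L @ m # R @ [b])"
    if "sublist x (a # L @ [m]) \<or> sublist x (m # R @ [b])" for x
  proof -
    have "sublist (a # L @ [m]) (a # L @ m # R @ [b])"
      unfolding sublist_def by (rule exI[of _ "[]"], rule exI[of _ "R @ [b]"]) simp
    moreover have "sublist (m # R @ [b]) (a # L @ m # R @ [b])"
      unfolding sublist_def by (rule exI[of _ "a # L"], rule exI[of _ "[]"]) simp
    ultimately have "sublist x (a # L @ m # R @ [b])"
      using that sublist_order.order_trans by blast
    moreover have "length x < length (a # L @ m # R @ [b])"
      using that by (auto dest!: sublist_length_le)
    ultimately show ?thesis unfolding strict_sublist_def by blast
  qed
  with \<open>?lhs\<close> show ?rhs unfolding avoids_def by blast
next
  assume ?rhs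
  show ?lhs
  proof (intro allI impI notI)
    fix a' u b'
    assume s: "strict_sublist (a' # u @ [b']) (a # L @ m # R @ [b])" and f: "framed c a' u b'"
    then have "sublist (a' # u @ [b']) (a # L @ m # R @ [b])"
      "\<not> (a' = a \<and> u = L @ m # R \<and> b' = b)"
      by (auto simp: strict_sublist_def)
    moreover have "\<forall>x\<in>set u. x < a' \<and> x < b'" using f by (simp add: framed_def)
    ultimately show False
      using sublist_dominated_cases[OF dist lt] \<open>?rhs\<close> f unfolding avoids_def by blast
  qed
qed

lemma avoids_split:
  assumes "distinct (a # L @ m # R @ [b])" "\<forall>x\<in>set L \<union> set R. x < m"
  shows "avoids c (a # L @ m # R @ [b]) \<longleftrightarrow>
    \<not> framed c a (L @ m # R) b \<and> avoids c (a # L @ [m]) \<and> avoids c (m # R @ [b])"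
proof -
  have "avoids c (a # L @ m # R @ [b]) \<longleftrightarrow> \<not> framed c a (L @ m # R) b \<and>
    (\<forall>a' u b'. strict_sublist (a' # u @ [b']) (a # L @ m # R @ [b]) \<longrightarrow> \<not> framed c a' u b')"
    (is "_ \<longleftrightarrow> ?rhs")
  proof
    assume "avoids c (a # L @ m # R @ [b])"
    moreover have "sublist (a # (L @ m # R) @ [b]) (a # L @ m # R @ [b])" by simp
    ultimately show ?rhs unfolding avoids_def strict_sublist_def by blast
  next
    assume rhs: ?rhs
    show "avoids c (a # L @ m # R @ [b])"
      unfolding avoids_def
    proof (intro allI impI)
      fix a' u b' assume "sublist (a' # u @ [b']) (a # L @ m # R @ [b])"
      then have "strict_sublist (a' # u @ [b']) (a # L @ m # R @ [b]) \<or>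
          a' # u @ [b'] = a # (L @ m # R) @ [b]"
        unfolding strict_sublist_def by auto
      then show "\<not> framed c a' u b'"
      proof
        assume "a' # u @ [b'] = a # (L @ m # R) @ [b]"
        then have "a' = a" "u = L @ m # R" "b' = b" by (metis append1_eq_conv list.inject)+
        then show ?thesis using rhs by simp
      qed (use rhs in blast)
    qed
  qed
  then show ?thesis using no_strict_framed_iff[OF assms] by simp
qed

section \<open>Avoiding words are good words\<close>

lemma hd_neq_last: "distinct u \<Longrightarrow> 2 \<le> length u \<Longrightarrow> hd u \<noteq> last u"
  by (cases u) (auto simp: Suc_le_eq)

text \<open>By \<open>decompose_unique\<close> the existential in \<open>rooted\<close> has only one
  possible witness.\<close>

lemma rooted_split_iff:
  assumes "\<forall>x\<in>set L \<union> set R. x < m"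
  shows "rooted d c (L @ m # rev R) \<longleftrightarrow> good c L \<and> good c R \<and>
    (2 \<le> length (L @ m # rev R) \<longrightarrow> d (hd (L @ m # rev R)) (last (L @ m # rev R)))"
    (is "?lhs \<longleftrightarrow> ?rhs")
proof
  assume ?lhs
  then obtain L' m' R' where *: "L @ m # rev R = L' @ m' # rev R'" "good c L'" "good c R'"
    "\<forall>x\<in>set L' \<union> set R'. x < m'"
    "2 \<le> length (L @ m # rev R) \<longrightarrow> d (hd (L @ m # rev R)) (last (L @ m # rev R))"
    unfolding rooted_def by blast
  have "L = L' \<and> m = m' \<and> rev R = rev R'"
    by (rule decompose_unique[OF *(1)]) (use *(4) assms in auto)
  then show ?rhs using * by simp
qed (use assms in \<open>auto simp: rooted_def\<close>)

text \<open>
  A comparison is reversed here, as avoiding \<open>c\<close> means satisfying \<open>c\<inverse>\<inverse>\<close>. Hence in a primitive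
  word the relation at the root is opposite to the one in the parts, and \<open>rooted\<close> has two
  relations.
\<close>

lemma avoids_iff_good:
  assumes "tournament c" "distinct (a # u @ [b])" "b < a" "\<forall>x\<in>set u. x < b"
  shows "avoids c (a # u @ [b]) \<longleftrightarrow> good c\<inverse>\<inverse> u"
  using assms(2-)
proof (induction "length u" arbitrary: a u b rule: less_induct)
  case less
  show ?case
  proof (cases "u = []")
    case True
    then show ?thesis
      by (auto simp: avoids_def framed_def good.Nil dest!: sublist_length_le)
  next
    case False
    then obtain L m R where u: "u = L @ m # rev R" and lt: "\<forall>x\<in>set L \<union> set R. x < m"
      using decompose_at_Max[of u] less.prems(1)
      by (metis distinct.simps(2) distinct_append)
    have "m < b" using less.prems(3) u by auto
    have L: "avoids c (a # L @ [m]) \<longleftrightarrow> good c\<inverse>\<inverse> L"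
      by (rule less.hyps) (use less.prems lt u in auto)
    \<comment> \<open>As \<open>m < b\<close>, only the reversal \<open>b # R @ [m]\<close> has its
      ends in the order that the induction hypothesis requires.\<close>
    have "avoids c (m # rev R @ [b]) \<longleftrightarrow> avoids c (rev (m # rev R @ [b]))"
      by (rule avoids_rev[symmetric]) (use less.prems u in auto)
    also have "\<dots> \<longleftrightarrow> avoids c (b # R @ [m])" by simp
    also have "\<dots> \<longleftrightarrow> good c\<inverse>\<inverse> R"
      by (rule less.hyps) (use less.prems lt u \<open>m < b\<close> in auto)
    finally have R: "avoids c (m # rev R @ [b]) \<longleftrightarrow> good c\<inverse>\<inverse> R" .
    have "\<forall>x\<in>set u. x < a \<and> x < b" using less.prems by auto
    \<comment> \<open>Since \<open>b < a\<close>, the first branch of \<open>framed\<close> applies.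
      Where \<open>c\<close> fails for two distinct letters, its converse holds.\<close>
    then have F: "\<not> framed c a u b \<longleftrightarrow> (2 \<le> length u \<longrightarrow> c\<inverse>\<inverse> (hd u) (last u))"
      unfolding framed_def using less.prems(1,2) hd_neq_last[of u] tournamentD[OF assms(1)]
      by auto
    have "avoids c (a # u @ [b]) \<longleftrightarrow>
        \<not> framed c a u b \<and> good c\<inverse>\<inverse> L \<and> good c\<inverse>\<inverse> R"
      using avoids_split[of a L m "rev R" b c] less.prems u lt L R by simp
    also have "\<dots> \<longleftrightarrow> rooted c\<inverse>\<inverse> c\<inverse>\<inverse> u"
      using rooted_split_iff[OF lt, of "c\<inverse>\<inverse>" "c\<inverse>\<inverse>"] F u by auto
    finally show ?thesis by (simp add: good_iff_rooted)
  qed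
qed

section \<open>Counting words\<close>

definition good_words :: "(nat \<Rightarrow> nat \<Rightarrow> bool) \<Rightarrow> nat set \<Rightarrow> nat list set" where
  "good_words c S = {u. distinct u \<and> set u = S \<and> good c u}"

definition rooted_words ::
    "(nat \<Rightarrow> nat \<Rightarrow> bool) \<Rightarrow> (nat \<Rightarrow> nat \<Rightarrow> bool) \<Rightarrow> nat set \<Rightarrow> nat list set" where
  "rooted_words d c S = {u. distinct u \<and> set u = S \<and> rooted d c u}"

lemma good_words_eq_rooted_words: "good_words c = rooted_words c c"
  by (simp add: good_words_def rooted_words_def good_iff_rooted fun_eq_iff)

lemma finite_rooted_words: "finite S \<Longrightarrow> finite (rooted_words d c S)"
  by (rule finite_subset[OF _ finite_permutations_of_set[of S]])
    (auto simp: rooted_words_def permutations_of_set_def)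

section \<open>The recurrence for words\<close>

text \<open>Represents each unordered pair of complementary parts of \<open>S - {Max S}\<close> by
  the part with the largest element; the other part may be empty. If \<open>S\<close> has at most
  one element, there are no splits.\<close>

definition max_splits :: "'a::linorder set \<Rightarrow> 'a set set" where
  "max_splits S = {V. V \<subseteq> S - {Max S} \<and> Max (S - {Max S}) \<in> V}"

lemma finite_max_splits: "finite S \<Longrightarrow> finite (max_splits S)"
  by (simp add: max_splits_def)

text \<open>Makes the comparison of the end letters symmetric in \<open>L\<close> and
  \<open>R\<close>; the appended \<open>m\<close> supplies the letter of an empty part.\<close>

lemma hd_last_split:
  "hd (L @ m # rev R) = hd (L @ [m])" "last (L @ m # rev R) = hd (R @ [m])"
  by (cases L; simp) (cases R; simp)

lemma max_splitsD:
  fixes S :: "'a::linorder set"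
  assumes "finite S" "V \<in> max_splits S" "W = S - {Max S} - V"
  shows "finite V" "finite W" "V \<inter> W = {}" "V \<union> W = S - {Max S}" "Max S \<in> S"
    "\<forall>x\<in>V \<union> W. x < Max S" "V \<noteq> {}" "Max V = Max (S - {Max S})"
proof -
  have V: "V \<subseteq> S - {Max S}" "Max (S - {Max S}) \<in> V"
    using assms(2) by (auto simp: max_splits_def)
  then show "V \<noteq> {}" and un: "V \<union> W = S - {Max S}" and "V \<inter> W = {}"
    using assms(3) by auto
  show fin: "finite V" "finite W" using V(1) assms(1,3) by (auto intro: finite_subset)
  show "Max S \<in> S" using V assms(1) by (intro Max_in) auto
  show "\<forall>x\<in>V \<union> W. x < Max S" unfolding un using assms(1)
    by (metis Diff_iff Max_ge order_less_le singletonI)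
  show "Max V = Max (S - {Max S})"
    by (rule Max_eqI) (use V fin assms(1) in \<open>auto intro: Max_ge\<close>)
qed

definition join_words :: "(nat \<Rightarrow> nat \<Rightarrow> bool) \<Rightarrow> nat \<Rightarrow> nat list \<Rightarrow> nat list \<Rightarrow> nat list" where
  "join_words d m X Y =
     (if d (hd (X @ [m])) (hd (Y @ [m])) then X @ m # rev Y else Y @ m # rev X)"

text \<open>Splitting a word at its maximum returns the two parts up to order, and the one holding
  \<open>Max (S - {Max S})\<close> is \<open>X\<close>. Conversely, \<open>d\<close> decides which
  part stands on the left.\<close>

lemma bij_betw_join_words:
  assumes d: "tournament d" and fin: "finite S" and two: "2 \<le> card S"
  shows "bij_betw (\<lambda>(V, X, Y). join_words d (Max S) X Y)
    (SIGMA V:max_splits S. good_words c V \<times> good_words c (S - {Max S} - V))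
    (rooted_words d c S)" (is "bij_betw ?F ?D ?B")
  unfolding bij_betw_def
proof
  let ?m = "Max S" and ?S' = "S - {Max S}"
  have D: "set X = V" "set Y = ?S' - V" "set X \<inter> set Y = {}" "distinct X" "distinct Y"
    "good c X" "good c Y" "set X \<union> set Y = ?S'" "?m \<in> S" "\<forall>x\<in>set X \<union> set Y. x < ?m"
    "Max ?S' \<in> set X" "Max ?S' \<notin> set Y" "X \<noteq> []"
    if "(V, X, Y) \<in> ?D" for V X Y
  proof -
    from that have V: "V \<in> max_splits S" and XY: "X \<in> good_words c V" "Y \<in> good_words c (?S' - V)"
      by auto
    show X: "set X = V" and Y: "set Y = ?S' - V" and "distinct X" "distinct Y" "good c X" "good c Y"
      using XY by (auto simp: good_words_def)
    note * = max_splitsD[OF fin V refl]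
    show "set X \<inter> set Y = {}" "set X \<union> set Y = ?S'" "?m \<in> S" "\<forall>x\<in>set X \<union> set Y. x < ?m"
      using * X Y by auto
    show "X \<noteq> []" using * X by auto
    show "Max ?S' \<in> set X" "Max ?S' \<notin> set Y" using V X Y by (auto simp: max_splits_def)
  qed
  show "inj_on ?F ?D"
  proof (rule inj_onI)
    fix t t' assume tt': "t \<in> ?D" "t' \<in> ?D" "?F t = ?F t'"
    obtain V X Y V' X' Y' where VXY: "t = (V, X, Y)" "t' = (V', X', Y')" by (metis prod_cases3)
    have t: "(V, X, Y) \<in> ?D" and t': "(V', X', Y') \<in> ?D"
      and eq: "join_words d ?m X Y = join_words d ?m X' Y'"
      using tt' unfolding VXY by simp_all
    note D = D[OF t] and D' = D[OF t']
    obtain P Q where PQ: "join_words d ?m X Y = P @ ?m # rev Q"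
      "P = X \<and> Q = Y \<or> P = Y \<and> Q = X" unfolding join_words_def by metis
    obtain P' Q' where PQ': "join_words d ?m X' Y' = P' @ ?m # rev Q'"
      "P' = X' \<and> Q' = Y' \<or> P' = Y' \<and> Q' = X'" unfolding join_words_def by metis
    have "P = P' \<and> ?m = ?m \<and> rev Q = rev Q'"
      by (rule decompose_unique) (use eq PQ PQ' D(10) D'(10) in auto)
    then have "X = X' \<and> Y = Y' \<or> X = Y' \<and> Y = X'" using PQ(2) PQ'(2) by auto
    \<comment> \<open>In the crossed case \<open>Max ?S'\<close> would lie in \<open>X = Y'\<close>,
      but only first parts contain it.\<close>
    then have "X = X' \<and> Y = Y'" using D(11) D'(12) by auto
    then show "t = t'" using D(1) D'(1) VXY by simp
  qed
  show "?F ` ?D = ?B"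
  proof (intro set_eqI iffI)
    fix u assume "u \<in> ?F ` ?D"
    then obtain V X Y where t: "(V, X, Y) \<in> ?D" and u: "u = join_words d ?m X Y" by auto
    note D = D[OF t]
    \<comment> \<open>If \<open>Y\<close> is empty, its letter is \<open>?m\<close>. As
      \<open>X\<close> is never empty, the compared letters always differ.\<close>
    have "hd (X @ [?m]) \<in> set X" using D(13) by simp
    moreover have "hd (Y @ [?m]) \<in> insert ?m (set Y)" by (cases Y) auto
    ultimately have neq: "hd (X @ [?m]) \<noteq> hd (Y @ [?m])" using D(3,10) by auto
    obtain P Q where PQ: "u = P @ ?m # rev Q" "P = X \<and> Q = Y \<or> P = Y \<and> Q = X"
      "d (hd (P @ [?m])) (hd (Q @ [?m]))"
      using tournamentD[OF d neq] u unfolding join_words_def by metis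
    have "set u = S" "distinct u" using PQ(1,2) D(3-5,8-10) by auto
    moreover have "\<forall>x\<in>set P \<union> set Q. x < ?m" and good: "good c P" "good c Q"
      using PQ(2) D(6,7,10) by auto
    then have "rooted d c u"
      unfolding PQ(1) by (subst rooted_split_iff) (use good PQ(3) in \<open>simp_all only: hd_last_split simp_thms\<close>)
    ultimately show "u \<in> ?B" by (simp add: rooted_words_def)
  next
    fix u assume "u \<in> ?B"
    then have u: "distinct u" "set u = S" "rooted d c u" by (auto simp: rooted_words_def)
    then have len: "length u = card S" using distinct_card by force
    then obtain L m R where LR: "u = L @ m # rev R" "good c L" "good c R"
      "\<forall>x\<in>set L \<union> set R. x < m" "d (hd u) (last u)"
      using u(3) two by (auto simp: rooted_def)
    have "m \<in> S" "\<forall>x\<in>S. x \<le> m" using LR(1,4) u(2)[symmetric] by (auto intro: less_imp_le)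
    then have m: "m = ?m" using fin by (metis Max_eqI)
    have dd: "d (hd (L @ [?m])) (hd (R @ [?m]))" using LR(1,5) m hd_last_split by metis
    have "S = insert m (set L \<union> set R)" "m \<notin> set L \<union> set R" using u(1,2) LR(1) by auto
    then have sets: "set L \<union> set R = ?S'" unfolding m[symmetric] by auto
    have disj: "set L \<inter> set R = {}" using u(1) LR(1) by auto
    have diff: "?S' - set L = set R" "?S' - set R = set L"
      unfolding sets[symmetric] using disj by auto
    have gw: "L \<in> good_words c (set L)" "R \<in> good_words c (set R)"
      using u(1) LR(1-3) by (simp_all add: good_words_def)
    have "card ?S' \<noteq> 0" using two \<open>m \<in> S\<close> fin m[symmetric] by simp
    then have "?S' \<noteq> {}" by (metis card.empty)
    then have "Max ?S' \<in> set L \<union> set R" unfolding sets using fin by (intro Max_in) auto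
    then show "u \<in> ?F ` ?D"
    proof
      assume "Max ?S' \<in> set L"
      then have "set L \<in> max_splits S" unfolding max_splits_def using sets by blast
      then have "(set L, L, R) \<in> ?D" using gw diff by simp
      moreover have "?F (set L, L, R) = u" unfolding LR(1) join_words_def m using dd by simp
      ultimately show ?thesis by (rule rev_image_eqI[where f = ?F, OF _ sym])
    next
      assume "Max ?S' \<in> set R"
      then have "set R \<in> max_splits S" unfolding max_splits_def using sets by blast
      then have "(set R, R, L) \<in> ?D" using gw diff by simp
      moreover
      \<comment> \<open>Now \<open>R\<close> is the first part. As \<open>d\<close> holds from
        \<open>L\<close> to \<open>R\<close>, it fails from \<open>R\<close> to \<open>L\<close>,
        and the second branch of \<open>join_words\<close> puts \<open>L\<close> back on the
        left.\<close>
      have "hd (L @ [?m]) \<noteq> hd (R @ [?m])"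
        using hd_neq_last[OF u(1)] len two LR(1) m hd_last_split by metis
      then have "\<not> d (hd (R @ [?m])) (hd (L @ [?m]))" using dd tournamentD[OF d] by blast
      then have "?F (set R, R, L) = u" unfolding LR(1) join_words_def m by simp
      ultimately show ?thesis by (rule rev_image_eqI[where f = ?F, OF _ sym])
    qed
  qed
qed

lemma finite_good_words: "finite S \<Longrightarrow> finite (good_words c S)"
  by (simp add: good_words_eq_rooted_words finite_rooted_words)

text \<open>The right-hand side is free of \<open>d\<close>: the relation at the outermost maximum
  only decides the order of the parts.\<close>

lemma card_rooted_words:
  assumes "tournament d" "finite S" "2 \<le> card S"
  shows "card (rooted_words d c S) =
    (\<Sum>V\<in>max_splits S. card (good_words c V) * card (good_words c (S - {Max S} - V)))"
proof -
  have "finite (good_words c V \<times> good_words c (S - {Max S} - V))" if "V \<in> max_splits S" for V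
    using max_splitsD(1,2)[OF assms(2) that refl] by (simp add: finite_good_words)
  then show ?thesis
    using bij_betw_same_card[OF bij_betw_join_words[OF assms, of c]] finite_max_splits[OF assms(2)]
    by (simp add: card_SigmaI card_cartesian_product)
qed

lemma card_rooted_words_small:
  assumes "finite S" "card S < 2"
  shows "card (rooted_words d c S) = 1"
proof (cases "S = {}")
  case True
  then have "rooted_words d c S = {[]}" by (auto simp: rooted_words_def rooted_def)
  then show ?thesis by simp
next
  case False
  then obtain x where x: "S = {x}"
    using assms by (metis card_1_singletonE card_eq_0_iff less_2_cases One_nat_def)
  have "rooted d c [x]" unfolding rooted_def
    by (intro disjI2 exI[of _ "[]"] exI[of _ x]) (auto intro: good.Nil)
  moreover have "distinct u \<and> set u = {x} \<longleftrightarrow> u = [x]" for u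
    by (metis distinct.simps distinct_singleton empty_set list.simps(15) set_empty
        distinct_card card_1_singleton_iff length_Suc_conv One_nat_def length_0_conv
        singleton_iff list.set_intros(1) is_singletonI is_singleton_altdef)
  ultimately have "rooted_words d c S = {[x]}" using x by (auto simp: rooted_words_def)
  then show ?thesis by simp
qed

section \<open>Counting trees\<close>

text \<open>Replaces the reachability in \<open>rooted_tree\<close> by local conditions, which are
  easy to check for joined and restricted edge sets. For \<open>P = {}\<close> only the empty edge
  set qualifies.\<close>

definition parent_tree :: "'a::linorder set \<Rightarrow> ('a \<times> 'a) set \<Rightarrow> bool" where
  "parent_tree P E \<longleftrightarrow> E \<subseteq> P \<times> P \<and> (\<forall>(x, y)\<in>E. x < y) \<and>
     (\<forall>x\<in>P - {Max P}. \<exists>!y. (x, y) \<in> E) \<and> (\<forall>y. card {x. (x, y) \<in> E} \<le> 2)"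

lemma parent_tree_Max:
  assumes "finite P" "parent_tree P E"
  shows "(Max P, y) \<notin> E"
proof
  assume "(Max P, y) \<in> E"
  then have "y \<in> P" "Max P < y" using assms(2) by (auto simp: parent_tree_def)
  then show False using Max_ge[OF assms(1), of y] by simp
qed

text \<open>Following parents increases the label, so the climb ends, and it can end only at
  \<open>Max P\<close>.\<close>

lemma parent_tree_reaches_Max:
  fixes P :: "nat set"
  assumes "finite P" "parent_tree P E" "x \<in> P"
  shows "(x, Max P) \<in> E\<^sup>*"
  using assms(3)
proof (induction "Max P - x" arbitrary: x rule: less_induct)
  case less
  show ?case
  proof (cases "x = Max P")
    case False
    then obtain y where y: "(x, y) \<in> E" using less.prems assms(2) unfolding parent_tree_def by blast
    then have "y \<in> P" "x < y" using assms(2) unfolding parent_tree_def by auto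
    moreover from this have "y \<le> Max P" using assms(1) by simp
    ultimately have "(y, Max P) \<in> E\<^sup>*" by (intro less.hyps) auto
    then show ?thesis using y by (rule converse_rtrancl_into_rtrancl[rotated])
  qed simp
qed

text \<open>Every vertex but the root has a larger parent, so the root is the maximum. Conversely, a
  larger parent at every other vertex makes all paths climb to the maximum.\<close>

lemma decreasing_012_tree_iff_parent_tree:
  assumes fin: "finite P"
  shows "decreasing_012_tree P E \<longleftrightarrow> parent_tree P E"
proof (cases "P = {}")
  case True
  then show ?thesis by (auto simp: decreasing_012_tree_def rooted_tree_def parent_tree_def)
next
  case False
  show ?thesis
  proof
    assume "decreasing_012_tree P E"
    with False have t: "rooted_tree P E" "\<forall>y\<in>P. card {x. (x, y) \<in> E} \<le> 2"
      "\<forall>x y. (x, y) \<in> E\<^sup>+ \<longrightarrow> x < y"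
      by (auto simp: decreasing_012_tree_def)
    then obtain r where r: "E \<subseteq> P \<times> P" "r \<in> P" "\<forall>x\<in>P - {r}. \<exists>!y. (x, y) \<in> E"
      by (auto simp: rooted_tree_def)
    have inc: "\<forall>(x, y)\<in>E. x < y" using t(3) by auto
    have "r = Max P"
    proof (rule ccontr)
      assume "r \<noteq> Max P"
      then obtain y where "(Max P, y) \<in> E" using r(3) Max_in[OF fin False] by blast
      then have "y \<in> P" "Max P < y" using r(1) inc by auto
      then show False using Max_ge[OF fin, of y] by simp
    qed
    moreover have "card {x. (x, y) \<in> E} \<le> 2" for y
    proof (cases "y \<in> P")
      case False
      then have "{x. (x, y) \<in> E} = {}" using r(1) by auto
      then show ?thesis by simp
    qed (use t in auto)
    ultimately show "parent_tree P E" using r inc by (auto simp: parent_tree_def)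
  next
    assume t: "parent_tree P E"
    then have "{x. (x, y) \<in> E} \<subseteq> P" for y by (auto simp: parent_tree_def)
    then have "finite {x. (x, y) \<in> E}" for y using fin finite_subset by blast
    moreover have "x < y" if "(x, y) \<in> E\<^sup>+" for x y
      using that by induction (use t in \<open>auto simp: parent_tree_def\<close>)
    moreover have "rooted_tree P E" unfolding rooted_tree_def
      using t Max_in[OF fin False] parent_tree_Max[OF fin t] parent_tree_reaches_Max[OF fin t]
      by (auto simp: parent_tree_def intro!: bexI[of _ "Max P"])
    ultimately show "decreasing_012_tree P E"
      using t by (auto simp: decreasing_012_tree_def parent_tree_def)
  qed
qed

section \<open>Joining two trees under a new root, and the inverse\<close>

definition parent_trees :: "'a::linorder set \<Rightarrow> ('a \<times> 'a) set set" where
  "parent_trees P = {E. parent_tree P E}"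

lemma finite_parent_trees: "finite P \<Longrightarrow> finite (parent_trees P)"
  by (rule finite_subset[of _ "Pow (P \<times> P)"]) (auto simp: parent_trees_def parent_tree_def)

text \<open>An empty branch contributes no edge, which produces roots with fewer than two
  children.\<close>

definition root_edge :: "'a::linorder \<Rightarrow> 'a set \<Rightarrow> ('a \<times> 'a) set" where
  "root_edge m V = (if V = {} then {} else {(Max V, m)})"

lemma root_edgeD: "finite V \<Longrightarrow> (x, y) \<in> root_edge m V \<Longrightarrow> x \<in> V \<and> y = m"
  using Max_in[of V] by (cases "V = {}") (auto simp: root_edge_def)

definition join_trees ::
    "'a::linorder \<Rightarrow> 'a set \<Rightarrow> 'a set \<Rightarrow> ('a \<times> 'a) set \<Rightarrow> ('a \<times> 'a) set \<Rightarrow> ('a \<times> 'a) set" where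
  "join_trees m V W E F = E \<union> F \<union> root_edge m V \<union> root_edge m W"

lemma join_trees_commute: "join_trees m V W E F = join_trees m W V F E"
  by (auto simp: join_trees_def)

lemma join_trees_parent_iff:
  assumes "finite V" "finite W" "V \<inter> W = {}" "parent_tree V E" "parent_tree W F" "x \<in> V"
  shows "(x, y) \<in> join_trees m V W E F \<longleftrightarrow> (if x = Max V then y = m else (x, y) \<in> E)"
proof -
  have "x \<notin> W" using assms by auto
  then have "(x, y) \<notin> F" "(x, y) \<notin> root_edge m W"
    using assms(5) root_edgeD[OF assms(2)] by (auto simp: parent_tree_def)
  then show ?thesis using assms(6) parent_tree_Max[OF assms(1,4)]
    by (auto simp: join_trees_def root_edge_def)
qed

text \<open>Edges of \<open>F\<close> end in \<open>W\<close> and the added edges end in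
  \<open>m\<close>, so only \<open>E\<close> supplies children inside \<open>V\<close>.\<close>

lemma join_trees_child_iff:
  assumes "V \<inter> W = {}" "parent_tree V E" "parent_tree W F" "y \<in> V" "m \<notin> V"
  shows "(x, y) \<in> join_trees m V W E F \<longleftrightarrow> (x, y) \<in> E"
proof -
  have "y \<notin> W" "y \<noteq> m" using assms by auto
  then show ?thesis using assms(3)
    by (auto simp: join_trees_def root_edge_def parent_tree_def)
qed

lemma join_trees_Int:
  assumes "V \<inter> W = {}" "parent_tree V E" "parent_tree W F" "m \<notin> V"
  shows "join_trees m V W E F \<inter> V \<times> V = E"
proof -
  have "E \<subseteq> V \<times> V" using assms(2) by (simp add: parent_tree_def)
  then show ?thesis using join_trees_child_iff[OF assms(1-3) _ assms(4)] by auto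
qed

text \<open>Recovers \<open>V\<close> from the joined tree and \<open>Max V\<close> alone. For
  \<open>V\<close> in \<open>max_splits S\<close>, \<open>Max V\<close> is known in advance, which
  is what injectivity needs.\<close>

lemma join_trees_descendants:
  fixes V :: "nat set"
  assumes "finite V" "V \<noteq> {}" "V \<inter> W = {}" "parent_tree V E" "parent_tree W F" "m \<notin> V"
  shows "{x. (x, Max V) \<in> (join_trees m V W E F)\<^sup>*} = V"
proof (intro equalityI subsetI CollectI)
  fix x assume "x \<in> V"
  then have "(x, Max V) \<in> E\<^sup>*" using parent_tree_reaches_Max assms by blast
  moreover have "E \<subseteq> join_trees m V W E F" by (auto simp: join_trees_def)
  ultimately show "(x, Max V) \<in> (join_trees m V W E F)\<^sup>*" using rtrancl_mono by blast
next
  fix x assume "x \<in> {x. (x, Max V) \<in> (join_trees m V W E F)\<^sup>*}"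
  then have "(x, Max V) \<in> (join_trees m V W E F)\<^sup>*" by simp
  then show "x \<in> V"
  proof (induction rule: converse_rtrancl_induct)
    case base
    then show ?case using assms by simp
  next
    case (step y z)
    then have "(y, z) \<in> E" using join_trees_child_iff assms by metis
    then show ?case using assms(4) by (auto simp: parent_tree_def)
  qed
qed

text \<open>Only \<open>Max V\<close> and \<open>Max W\<close> gain a parent, and only
  \<open>m\<close> gains children, at most these two.\<close>

lemma parent_tree_join_trees:
  assumes "finite V" "finite W" "V \<inter> W = {}" "parent_tree V E" "parent_tree W F"
    and lt: "\<forall>x\<in>V \<union> W. x < m"
  shows "parent_tree (insert m (V \<union> W)) (join_trees m V W E F)"
proof -
  let ?G = "join_trees m V W E F"
  have W: "W \<inter> V = {}" using assms by blast
  have m: "m \<notin> V" "m \<notin> W" using lt by auto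
  have Max: "Max (insert m (V \<union> W)) = m"
    by (rule Max_eqI) (use assms in \<open>auto intro: less_imp_le\<close>)
  have "?G \<subseteq> insert m (V \<union> W) \<times> insert m (V \<union> W)"
    using assms Max_in[of V] Max_in[of W]
    by (auto simp: join_trees_def root_edge_def parent_tree_def split: if_splits)
  moreover have "\<forall>(x, y)\<in>?G. x < y"
    using assms Max_in[of V] Max_in[of W]
    by (auto simp: join_trees_def root_edge_def parent_tree_def split: if_splits)
  moreover have "\<exists>!y. (x, y) \<in> ?G" if "x \<in> V \<union> W" for x
    using that
  proof
    assume x: "x \<in> V"
    then have "x \<noteq> Max V \<longrightarrow> (\<exists>!y. (x, y) \<in> E)" using assms(4) by (simp add: parent_tree_def)
    then show ?thesis
      unfolding join_trees_parent_iff[OF assms(1-5) x] by (cases "x = Max V") simp_all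
  next
    assume x: "x \<in> W"
    then have "x \<noteq> Max W \<longrightarrow> (\<exists>!y. (x, y) \<in> F)" using assms(5) by (simp add: parent_tree_def)
    then show ?thesis
      unfolding join_trees_commute[of m V W] join_trees_parent_iff[OF assms(2,1) W assms(5,4) x]
      by (cases "x = Max W") simp_all
  qed
  moreover have "card {x. (x, y) \<in> ?G} \<le> 2" for y
  proof -
    consider "y \<in> V" | "y \<in> W" | "y = m" | "y \<notin> insert m (V \<union> W)" by blast
    then show ?thesis
    proof cases
      case 1
      then show ?thesis
        using assms(4) join_trees_child_iff[OF assms(3-5) _ m(1)] by (simp add: parent_tree_def)
    next
      case 2
      then show ?thesis
        using assms(5) join_trees_child_iff[OF W assms(5,4) _ m(2)]
        unfolding join_trees_commute[of m V W] by (simp add: parent_tree_def)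
    next
      case 3
      \<comment> \<open>An upper bound suffices: the unspecified \<open>Max\<close> of an empty
        branch only enlarges the right-hand set.\<close>
      then have "{x. (x, y) \<in> ?G} \<subseteq> {Max V, Max W}"
        using assms(4,5) m
        by (auto simp: join_trees_def root_edge_def parent_tree_def split: if_splits)
      then have "card {x. (x, y) \<in> ?G} \<le> card {Max V, Max W}" by (intro card_mono) auto
      also have "\<dots> \<le> 2" by (simp add: card_insert_if)
      finally show ?thesis .
    next
      case 4
      then have "{x. (x, y) \<in> ?G} = {}" using \<open>?G \<subseteq> _\<close> by auto
      then show ?thesis by simp
    qed
  qed
  ultimately show ?thesis unfolding parent_tree_def Max by auto
qed

text \<open>The largest vertex \<open>?k\<close> below the root is a child of the root, and so is
  \<open>Max W\<close> if vertices \<open>W\<close> remain outside the branch of \<open>?k\<close>.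
  The bound of two children then makes \<open>W\<close> a single branch.\<close>

lemma parent_tree_obtain_join:
  fixes S :: "nat set"
  assumes fin: "finite S" and two: "2 \<le> card S" and t: "parent_tree S G"
  obtains V E F where "V \<in> max_splits S" "parent_tree V E" "parent_tree (S - {Max S} - V) F"
    "G = join_trees (Max S) V (S - {Max S} - V) E F"
proof -
  let ?m = "Max S" and ?S' = "S - {Max S}"
  let ?k = "Max ?S'"
  \<comment> \<open>The maximum of \<open>?S'\<close> has no possible parent but the root, so its descendants form one branch.\<close>
  define V where "V = {x. (x, ?k) \<in> G\<^sup>*}"
  define W where "W = ?S' - V"
  have sub: "G \<subseteq> S \<times> S" and inc: "\<And>x y. (x, y) \<in> G \<Longrightarrow> x < y"
    and ex: "\<And>x. x \<in> ?S' \<Longrightarrow> \<exists>!y. (x, y) \<in> G" and two_ch: "\<And>y. card {x. (x, y) \<in> G} \<le> 2"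
    using t by (auto simp: parent_tree_def)
  have root: "(?m, y) \<notin> G" for y by (rule parent_tree_Max[OF fin t])
  have "S \<noteq> {}" using two by auto
  then have m: "?m \<in> S" using fin by simp
  have "card ?S' \<noteq> 0" using two m fin by simp
  then have "?S' \<noteq> {}" by (metis card.empty)
  then have k: "?k \<in> ?S'" using fin by (intro Max_in) auto
  have le_k: "x \<le> ?k" if "x \<in> ?S'" for x using fin that by (intro Max_ge) auto
  have kV: "?k \<in> V" by (simp add: V_def)
  have down: "x \<in> V" if "(x, y) \<in> G" "y \<in> V" for x y
    using that unfolding V_def by (auto intro: converse_rtrancl_into_rtrancl)
  \<comment> \<open>The path from \<open>x\<close> to \<open>?k\<close> starts with an edge to the
    only parent of \<open>x\<close>, which is \<open>y\<close>.\<close>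
  have up: "y \<in> V" if xy: "(x, y) \<in> G" and xV: "x \<in> V" and "x \<noteq> ?k" for x y
  proof -
    have "(x, ?k) \<in> G\<^sup>*" using xV by (simp add: V_def)
    then obtain z where z: "(x, z) \<in> G" "(z, ?k) \<in> G\<^sup>*" using \<open>x \<noteq> ?k\<close> by (meson converse_rtranclE)
    have "x \<in> ?S'" using xy sub root by auto
    then have "z = y" using ex xy z(1) by blast
    then show ?thesis using z(2) by (simp add: V_def)
  qed
  have VS: "V \<subseteq> ?S'"
  proof
    fix x assume "x \<in> V"
    then have "(x, ?k) \<in> G\<^sup>*" by (simp add: V_def)
    then show "x \<in> ?S'"
      by (cases rule: converse_rtranclE) (use k sub root in auto)
  qed
  then have split: "V \<in> max_splits S" using kV by (simp add: max_splits_def)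
  note s = max_splitsD[OF fin split W_def]
  have k_parent: "(?k, y) \<in> G \<longleftrightarrow> y = ?m" for y
  proof -
    have *: "y = ?m" if "(?k, y) \<in> G" for y
      using inc[OF that] le_k[of y] sub that by (cases "y = ?m") auto
    then show ?thesis using ex[OF k] by metis
  qed
  have W_parent: "y \<in> W \<union> {?m}" if "(x, y) \<in> G" "x \<in> W" for x y
    using that down sub by (auto simp: W_def)
  have max_W: "(Max W, y) \<in> G \<longleftrightarrow> y = ?m" if "W \<noteq> {}" for y
  proof -
    have W: "Max W \<in> W" using s(2) that by simp
    have *: "y = ?m" if "(Max W, y) \<in> G" for y
      using inc[OF that] W_parent[OF that W] Max_ge[OF s(2), of y] by auto
    have "Max W \<in> ?S'" using W by (simp add: W_def)
    then show ?thesis using ex * by metis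
  qed
  \<comment> \<open>Any other child of the root in \<open>W\<close> would be its third child, next
    to \<open>?k\<close> and \<open>Max W\<close>.\<close>
  have W_to_root: "x = Max W" if "(x, ?m) \<in> G" "x \<in> W" for x
  proof (rule ccontr)
    assume "x \<noteq> Max W"
    moreover have W: "Max W \<in> W" using s(2) that(2) Max_in by blast
    moreover have "?k \<notin> W" using kV by (simp add: W_def)
    ultimately have "x \<noteq> Max W" "x \<noteq> ?k" "Max W \<noteq> ?k" using that(2) by metis+
    then have "card {x, Max W, ?k} = 3" by simp
    moreover have "{x, Max W, ?k} \<subseteq> {x. (x, ?m) \<in> G}"
      using that k_parent max_W by auto
    moreover have "finite {x. (x, ?m) \<in> G}"
      by (rule finite_subset[OF _ fin]) (use sub in auto)
    ultimately have "3 \<le> card {x. (x, ?m) \<in> G}" by (metis card_mono)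
    then show False using two_ch[of ?m] by simp
  qed
  \<comment> \<open>A set of non-root vertices carries a tree if it contains the parents of all its
    members but its maximum.\<close>
  have sub_tree: "parent_tree U (G \<inter> U \<times> U)"
    if U: "U \<subseteq> ?S'" "\<And>x y. (x, y) \<in> G \<Longrightarrow> x \<in> U \<Longrightarrow> x \<noteq> Max U \<Longrightarrow> y \<in> U" for U
  proof -
    have "\<exists>!y. (x, y) \<in> G \<inter> U \<times> U" if "x \<in> U - {Max U}" for x
      using ex[of x] U that by blast
    moreover have "card {x. (x, y) \<in> G \<inter> U \<times> U} \<le> 2" for y
    proof -
      have "finite {x. (x, y) \<in> G}"
        by (rule finite_subset[OF _ fin]) (use sub in auto)
      then have "card {x. (x, y) \<in> G \<inter> U \<times> U} \<le> card {x. (x, y) \<in> G}"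
        by (intro card_mono) auto
      then show ?thesis using two_ch[of y] by simp
    qed
    ultimately show ?thesis using inc unfolding parent_tree_def by auto
  qed
  have "parent_tree V (G \<inter> V \<times> V)"
    using VS up s(8) by (intro sub_tree) auto
  moreover have "parent_tree W (G \<inter> W \<times> W)"
    using W_parent W_to_root by (intro sub_tree) (auto simp: W_def)
  moreover have "G = join_trees ?m V W (G \<inter> V \<times> V) (G \<inter> W \<times> W)" (is "G = ?J")
  proof (intro equalityI subsetI)
    fix e assume "e \<in> G"
    then obtain x y where e: "e = (x, y)" "(x, y) \<in> G" by (cases e) auto
    have "x \<in> V \<union> W" using e(2) sub root by (auto simp: s(4))
    then show "e \<in> ?J"
    proof
      assume x: "x \<in> V"
      show ?thesis
      proof (cases "x = ?k")
        case True
        then show ?thesis using e k_parent s(7,8) by (auto simp: join_trees_def root_edge_def)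
      next
        case False
        then show ?thesis using e x up by (auto simp: join_trees_def)
      qed
    next
      assume x: "x \<in> W"
      then show ?thesis
        using e W_parent[OF e(2) x] W_to_root by (auto simp: join_trees_def root_edge_def)
    qed
  next
    fix e assume "e \<in> ?J"
    then show "e \<in> G"
      using k_parent max_W s(8) by (auto simp: join_trees_def root_edge_def split: if_splits)
  qed
  ultimately show ?thesis using that split unfolding W_def by blast
qed

text \<open>\<open>V\<close> is recovered as the descendants of \<open>Max (S - {Max S})\<close>,
  then \<open>E\<close> and \<open>F\<close> as the edges inside the two vertex sets. Surjectivity
  is \<open>parent_tree_obtain_join\<close>.\<close>

lemma bij_betw_join_trees:
  fixes S :: "nat set"
  assumes fin: "finite S" and two: "2 \<le> card S"
  shows "bij_betw (\<lambda>(V, E, F). join_trees (Max S) V (S - {Max S} - V) E F)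
    (SIGMA V:max_splits S. parent_trees V \<times> parent_trees (S - {Max S} - V))
    (parent_trees S)" (is "bij_betw ?J ?D _")
  unfolding bij_betw_def
proof
  show "inj_on ?J ?D"
  proof (rule inj_onI)
    fix t t' assume tt': "t \<in> ?D" "t' \<in> ?D" "?J t = ?J t'"
    obtain V E F V' E' F' where VEF: "t = (V, E, F)" "t' = (V', E', F')" by (metis prod_cases3)
    let ?W = "S - {Max S} - V" and ?W' = "S - {Max S} - V'"
    have V: "V \<in> max_splits S" "E \<in> parent_trees V" "F \<in> parent_trees ?W"
      and V': "V' \<in> max_splits S" "E' \<in> parent_trees V'" "F' \<in> parent_trees ?W'"
      and eq: "join_trees (Max S) V ?W E F = join_trees (Max S) V' ?W' E' F'"
      using tt' unfolding VEF by simp_all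
    note s = max_splitsD[OF fin V(1) refl] and s' = max_splitsD[OF fin V'(1) refl]
    have t: "parent_tree V E" "parent_tree ?W F" "parent_tree V' E'" "parent_tree ?W' F'"
      using V V' by (auto simp: parent_trees_def)
    have m: "Max S \<notin> V" "Max S \<notin> ?W" "Max S \<notin> V'" using s(6) s'(6) by auto
    have VV: "V = V'"
      using join_trees_descendants[OF s(1,7,3) t(1,2) m(1)]
        join_trees_descendants[OF s'(1,7,3) t(3,4) m(3)] s(8) s'(8) eq by simp
    have "E = E'"
      using join_trees_Int[OF s(3) t(1,2) m(1)] join_trees_Int[OF s'(3) t(3,4) m(3)] eq VV by simp
    have "?W \<inter> V = {}" by blast
    \<comment> \<open>With the branches swapped, \<open>join_trees_Int\<close> returns
      \<open>F\<close> in place of \<open>E\<close>.\<close>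
    moreover have "join_trees (Max S) ?W V F E = join_trees (Max S) ?W V F' E'"
      using eq unfolding VV[symmetric] join_trees_commute[of "Max S" V] by simp
    ultimately have "F = F'"
      using join_trees_Int[of ?W V F E "Max S"] join_trees_Int[of ?W V F' E' "Max S"] t m VV by auto
    then show "t = t'" using VV \<open>E = E'\<close> VEF by simp
  qed
  show "?J ` ?D = parent_trees S"
  proof (intro equalityI subsetI)
    fix G assume "G \<in> ?J ` ?D"
    then obtain V E F where V: "V \<in> max_splits S" "parent_tree V E"
      "parent_tree (S - {Max S} - V) F" "G = join_trees (Max S) V (S - {Max S} - V) E F"
      by (auto simp: parent_trees_def)
    note s = max_splitsD[OF fin V(1) refl]
    have "insert (Max S) (V \<union> (S - {Max S} - V)) = S" using s(4,5) by auto
    then show "G \<in> parent_trees S"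
      using parent_tree_join_trees[OF s(1-3) V(2,3) s(6)] V(4) by (simp add: parent_trees_def)
  next
    fix G assume "G \<in> parent_trees S"
    then have "parent_tree S G" by (simp add: parent_trees_def)
    then obtain V E F where "V \<in> max_splits S" "parent_tree V E"
      "parent_tree (S - {Max S} - V) F" "G = join_trees (Max S) V (S - {Max S} - V) E F"
      by (rule parent_tree_obtain_join[OF assms])
    then show "G \<in> ?J ` ?D" by (auto simp: parent_trees_def image_iff intro!: bexI[of _ "(V, E, F)"])
  qed
qed

lemma card_parent_trees:
  fixes S :: "nat set"
  assumes "finite S" "2 \<le> card S"
  shows "card (parent_trees S) =
    (\<Sum>V\<in>max_splits S. card (parent_trees V) * card (parent_trees (S - {Max S} - V)))"
proof -
  have "finite (parent_trees V \<times> parent_trees (S - {Max S} - V))" if "V \<in> max_splits S" for V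
    using max_splitsD(1,2)[OF assms(1) that refl] by (simp add: finite_parent_trees)
  then show ?thesis
    using bij_betw_same_card[OF bij_betw_join_trees[OF assms]] finite_max_splits[OF assms(1)]
    by (simp add: card_SigmaI card_cartesian_product)
qed

lemma card_parent_trees_small:
  fixes S :: "nat set"
  assumes "finite S" "card S < 2"
  shows "card (parent_trees S) = 1"
proof -
  have "S = {} \<or> (\<exists>x. S = {x})"
    using assms by (metis card_1_singletonE card_eq_0_iff less_2_cases One_nat_def)
  then have "parent_trees S = {{}}"
    by (auto simp: parent_trees_def parent_tree_def)
  then show ?thesis by simp
qed

text \<open>Both sides obey the same recurrence. The induction keeps \<open>c\<close> fixed and
  \<open>d\<close> arbitrary, because the parts are good words, that is, rooted words with
  \<open>c\<close> in place of \<open>d\<close>.\<close>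

lemma card_rooted_words_eq_card_parent_trees:
  assumes "tournament c" "tournament d" "finite S"
  shows "card (rooted_words d c S) = card (parent_trees S)"
  using assms(2,3)
proof (induction "card S" arbitrary: S d rule: less_induct)
  case less
  show ?case
  proof (cases "card S < 2")
    case True
    then show ?thesis using less.prems by (simp add: card_rooted_words_small card_parent_trees_small)
  next
    case False
    have "card (good_words c V) * card (good_words c (S - {Max S} - V)) =
        card (parent_trees V) * card (parent_trees (S - {Max S} - V))"
      if V: "V \<in> max_splits S" for V
    proof -
      note s = max_splitsD[OF less.prems(2) V refl]
      have "card V < card S" "card (S - {Max S} - V) < card S"
        using s(4,5) less.prems(2) by (auto intro!: psubset_card_mono)
      then show ?thesis
        using less.hyps[OF _ assms(1)] s(1,2) by (simp add: good_words_eq_rooted_words)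
    qed
    then show ?thesis using False less.prems
      by (simp add: card_rooted_words card_parent_trees)
  qed
qed

section \<open>Primitive words\<close>

definition extremal_word :: "(nat \<Rightarrow> nat \<Rightarrow> bool) \<Rightarrow> nat set \<Rightarrow> nat list \<Rightarrow> bool" where
  "extremal_word c P w \<longleftrightarrow> perm_word P w \<and> card P \<ge> 2 \<and>
     hd w = Max P \<and> last w = Max (P - {hd w}) \<and>
     (card P \<ge> 4 \<longrightarrow> c (w ! 1) (w ! (card P - 2)))"

definition primitive_word :: "(nat \<Rightarrow> nat \<Rightarrow> bool) \<Rightarrow> nat set \<Rightarrow> nat list \<Rightarrow> bool" where
  "primitive_word c P w \<longleftrightarrow> extremal_word c P w \<and>
     (\<forall>x. strict_sublist x w \<and> length x \<ge> 4 \<longrightarrow>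
        \<not> extremal_word c (set x) x \<and> \<not> extremal_word c (set x) (rev x))"

lemma primitive_G_word_eq: "primitive_G_word = primitive_word (>)"
  by (simp add: fun_eq_iff primitive_G_word_def primitive_word_def G_word_def extremal_word_def)

lemma primitive_R_word_eq: "primitive_R_word = primitive_word (<)"
  by (simp add: fun_eq_iff primitive_R_word_def primitive_word_def R_word_def extremal_word_def)

text \<open>The set has \<open>length u + 2\<close> elements, so the threshold 4 becomes 2 for
  \<open>u\<close>, and the indices \<open>1\<close> and \<open>card P - 2\<close> point to the ends
  of \<open>u\<close>.\<close>

lemma extremal_word_iff:
  assumes "distinct (a # u @ [b])" "0 \<notin> set (a # u @ [b])"
  shows "extremal_word c (set (a # u @ [b])) (a # u @ [b]) \<longleftrightarrow>
    b < a \<and> (\<forall>x\<in>set u. x < b) \<and> (2 \<le> length u \<longrightarrow> c (hd u) (last u))"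
proof -
  let ?w = "a # u @ [b]"
  have card: "card (set ?w) = length u + 2" using distinct_card[OF assms(1)] by simp
  have "a = Max (set ?w) \<longleftrightarrow> (\<forall>x\<in>set u. x < a) \<and> b < a"
    using assms(1) by (subst eq_Max_iff) (auto simp: less_le)
  moreover have "set ?w - {a} = set (u @ [b])" using assms(1) by auto
  moreover have "b = Max (set (u @ [b])) \<longleftrightarrow> (\<forall>x\<in>set u. x < b)"
    using assms(1) by (subst eq_Max_iff) (auto simp: less_le)
  moreover have "?w ! 1 = hd u \<and> ?w ! (card (set ?w) - 2) = last u" if "2 \<le> length u"
  proof -
    have "u \<noteq> []" using that by auto
    then show ?thesis unfolding card
      by (auto simp: nth_append hd_conv_nth last_conv_nth nth_Cons split: nat.splits)
  qed
  moreover have "perm_word (set ?w) ?w"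
    unfolding perm_word_def using assms by (simp add: permutations_of_set_def)
  ultimately show ?thesis unfolding extremal_word_def card by auto
qed

text \<open>The larger end letter comes first in an extremal word, so the order of \<open>a\<close>
  and \<open>b\<close> decides which reading can be extremal. These are the two branches of
  \<open>framed\<close>.\<close>

lemma extremal_word_or_rev_iff_framed:
  assumes "distinct (a # u @ [b])" "0 \<notin> set (a # u @ [b])" "2 \<le> length u"
  shows "extremal_word c (set (a # u @ [b])) (a # u @ [b]) \<or>
    extremal_word c (set (a # u @ [b])) (rev (a # u @ [b])) \<longleftrightarrow> framed c a u b"
proof -
  let ?w = "a # u @ [b]"
  have rev: "rev ?w = b # rev u @ [a]" by simp
  have "extremal_word c (set (rev ?w)) (rev ?w) \<longleftrightarrow>
      a < b \<and> (\<forall>x\<in>set (rev u). x < a) \<and> (2 \<le> length (rev u) \<longrightarrow> c (hd (rev u)) (last (rev u)))"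
    unfolding rev by (rule extremal_word_iff) (use assms in auto)
  then have R: "extremal_word c (set ?w) (rev ?w) \<longleftrightarrow>
      a < b \<and> (\<forall>x\<in>set u. x < a) \<and> c (last u) (hd u)"
    unfolding set_rev using assms(3) by (simp add: hd_rev last_rev)
  show ?thesis
    unfolding R extremal_word_iff[OF assms(1,2)] framed_def
    using assms(1,3) by (cases a b rule: linorder_cases) auto
qed

lemma no_proper_extremal_iff:
  assumes "distinct w" "0 \<notin> set w"
  shows "(\<forall>x. strict_sublist x w \<and> length x \<ge> 4 \<longrightarrow>
        \<not> extremal_word c (set x) x \<and> \<not> extremal_word c (set x) (rev x)) \<longleftrightarrow>
    (\<forall>a u b. strict_sublist (a # u @ [b]) w \<longrightarrow> \<not> framed c a u b)" (is "?lhs \<longleftrightarrow> ?rhs")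
proof -
  have *: "distinct x" "0 \<notin> set x" if "strict_sublist x w" for x
    using that assms by (auto simp: strict_sublist_def sublist_def)
  show ?thesis
  proof (intro iffI allI impI)
    fix a u b
    assume lhs: ?lhs and s: "strict_sublist (a # u @ [b]) w"
    show "\<not> framed c a u b"
    proof (cases "2 \<le> length u")
      case True
      then have "length (a # u @ [b]) \<ge> 4" by simp
      then show ?thesis
        using extremal_word_or_rev_iff_framed[OF *[OF s] True] lhs s by blast
    qed (simp add: framed_def)
  next
    fix x assume rhs: ?rhs and s: "strict_sublist x w \<and> length x \<ge> 4"
    then obtain a y where ay: "x = a # y" by (cases x) auto
    with s obtain u b where ub: "y = u @ [b]" by (cases y rule: rev_cases) auto
    have x: "x = a # u @ [b]" and len: "2 \<le> length u" using ay ub s by auto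
    show "\<not> extremal_word c (set x) x \<and> \<not> extremal_word c (set x) (rev x)"
      using extremal_word_or_rev_iff_framed[OF _ _ len, of a b c] *[of x] s rhs
      unfolding x by blast
  qed
qed

text \<open>The word itself has to satisfy \<open>c\<close> at the ends of \<open>u\<close>, while
  its two halves avoid \<open>c\<close> and so have inner words that are good for the
  converse.\<close>

lemma strict_framed_iff_good:
  assumes c: "tournament c" and dist: "distinct (a # u @ [b])" and ab: "b < a"
    and lt: "\<forall>x\<in>set u. x < b"
  shows "(\<forall>a' v b'. strict_sublist (a' # v @ [b']) (a # u @ [b]) \<longrightarrow> \<not> framed c a' v b') \<and>
      (2 \<le> length u \<longrightarrow> c (hd u) (last u)) \<longleftrightarrow> rooted c c\<inverse>\<inverse> u"
proof (cases "u = []")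
  case True
  have "\<not> framed c a' v b'" if "strict_sublist (a' # v @ [b']) [a, b]" for a' v b'
    using that by (auto simp: strict_sublist_def framed_def dest!: sublist_length_le)
  then show ?thesis using True by (auto simp: rooted_def)
next
  case False
  then obtain L m R where u: "u = L @ m # rev R" and mlt: "\<forall>x\<in>set L \<union> set R. x < m"
    using decompose_at_Max[of u] dist by (metis distinct.simps(2) distinct_append)
  have "m < b" using lt u by auto
  have L: "avoids c (a # L @ [m]) \<longleftrightarrow> good c\<inverse>\<inverse> L"
    by (rule avoids_iff_good[OF c]) (use dist ab lt u mlt in auto)
  have "avoids c (m # rev R @ [b]) \<longleftrightarrow> avoids c (rev (m # rev R @ [b]))"
    by (rule avoids_rev[symmetric]) (use dist u in auto)
  also have "\<dots> \<longleftrightarrow> avoids c (b # R @ [m])" by simp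
  also have "\<dots> \<longleftrightarrow> good c\<inverse>\<inverse> R"
    by (rule avoids_iff_good[OF c]) (use dist u mlt \<open>m < b\<close> in auto)
  finally have R: "avoids c (m # rev R @ [b]) \<longleftrightarrow> good c\<inverse>\<inverse> R" .
  have "(\<forall>a' v b'. strict_sublist (a' # v @ [b']) (a # u @ [b]) \<longrightarrow> \<not> framed c a' v b') \<longleftrightarrow>
      good c\<inverse>\<inverse> L \<and> good c\<inverse>\<inverse> R"
    using no_strict_framed_iff[of a L m "rev R" b c] dist mlt u L R by simp
  then show ?thesis using rooted_split_iff[OF mlt, of c "c\<inverse>\<inverse>"] u by auto
qed

text \<open>The two largest letters are forced to the ends, so only the inner word \<open>u\<close>
  is free.\<close>

lemma primitive_word_atLeastAtMost_iff:
  assumes c: "tournament c" and n: "2 \<le> n"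
  shows "primitive_word c {1..n} w \<longleftrightarrow>
    (\<exists>u\<in>rooted_words c c\<inverse>\<inverse> {1..n - 2}. w = n # u @ [n - 1])"
proof -
  let ?P = "{1..n}"
  \<comment> \<open>For \<open>n = 2\<close> the interval \<open>{1..n - 2}\<close> is empty, and so
    is the inner word.\<close>
  have P: "?P = insert n (insert (n - 1) {1..n - 2})" using n by auto
  have P_minus: "?P - {n, n - 1} = {1..n - 2}" using n by auto
  have *: "primitive_word c ?P (n # u @ [n - 1]) \<longleftrightarrow> rooted c c\<inverse>\<inverse> u"
    if u: "set u = {1..n - 2}" "distinct u" for u
  proof -
    let ?w = "n # u @ [n - 1]"
    have w: "set ?w = ?P" "distinct ?w" "0 \<notin> set ?w" "n - 1 < n" "\<forall>x\<in>set u. x < n - 1"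
      using u n P by auto
    have "primitive_word c ?P ?w \<longleftrightarrow> (2 \<le> length u \<longrightarrow> c (hd u) (last u)) \<and>
        (\<forall>a v b. strict_sublist (a # v @ [b]) ?w \<longrightarrow> \<not> framed c a v b)"
      unfolding primitive_word_def no_proper_extremal_iff[OF w(2,3)]
      using extremal_word_iff[OF w(2,3), of c] w(1,4,5) by simp
    then show ?thesis using strict_framed_iff_good[OF c w(2,4,5)] by blast
  qed
  show ?thesis
  proof
    assume w: "primitive_word c ?P w"
    then have e: "perm_word ?P w" "hd w = Max ?P" "last w = Max (?P - {hd w})"
      by (auto simp: primitive_word_def extremal_word_def)
    then have w_set: "set w = ?P" "distinct w" by (auto simp: perm_word_def permutations_of_set_def)
    have "Max ?P = n" by (rule Max_eqI) (use n in auto)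
    then have hd: "hd w = n" using e(2) by simp
    have "Max (?P - {n}) = n - 1" by (rule Max_eqI) (use n in auto)
    then have last: "last w = n - 1" using e(3) hd by simp
    obtain y where y: "w = n # y" using hd w_set(1) n by (cases w) auto
    then have "y \<noteq> []" using last n by auto
    then obtain u where wu: "w = n # u @ [n - 1]"
      using last y by (metis append_butlast_last_id last_ConsR)
    have "set u = set w - {n, n - 1}" "distinct u" using w_set(2) wu by auto
    then have "set u = {1..n - 2}" "distinct u" unfolding w_set(1) P_minus .
    then have "u \<in> rooted_words c c\<inverse>\<inverse> {1..n - 2}"
      using *[of u] w wu by (simp add: rooted_words_def)
    then show "\<exists>u\<in>rooted_words c c\<inverse>\<inverse> {1..n - 2}. w = n # u @ [n - 1]" using wu by blast
  next
    assume "\<exists>u\<in>rooted_words c c\<inverse>\<inverse> {1..n - 2}. w = n # u @ [n - 1]"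
    then obtain u where "u \<in> rooted_words c c\<inverse>\<inverse> {1..n - 2}" "w = n # u @ [n - 1]" by blast
    then show "primitive_word c ?P w" using *[of u] by (simp add: rooted_words_def)
  qed
qed

lemma card_primitive_words:
  assumes "tournament c" "2 \<le> n"
  shows "card {w. primitive_word c {1..n} w} = card {E. decreasing_012_tree {1..n - 2} E}"
proof -
  have c': "tournament c\<inverse>\<inverse>" using assms(1) unfolding tournament_def conversep_iff by blast
  have "{w. primitive_word c {1..n} w} =
      (\<lambda>u. n # u @ [n - 1]) ` rooted_words c c\<inverse>\<inverse> {1..n - 2}"
    using primitive_word_atLeastAtMost_iff[OF assms] by auto
  then have "card {w. primitive_word c {1..n} w} = card (rooted_words c c\<inverse>\<inverse> {1..n - 2})"
    by (simp add: card_image inj_on_def)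
  \<comment> \<open>The converse of \<open>c\<close> governs the parts and \<open>c\<close> the
    root.\<close>
  also have "\<dots> = card (parent_trees {1..n - 2})"
    by (rule card_rooted_words_eq_card_parent_trees[OF c' assms(1)]) simp
  also have "parent_trees {1..n - 2} = {E. decreasing_012_tree {1..n - 2} E}"
    by (simp add: parent_trees_def decreasing_012_tree_iff_parent_tree)
  finally show ?thesis .
qed

theorem theorem3:
  fixes n :: nat
  assumes "n \<ge> 2"
  shows "card {w. primitive_G_word {1..n} w} = card {E. decreasing_012_tree {1..n - 2} E} \<and>
         card {w. primitive_R_word {1..n} w} = card {E. decreasing_012_tree {1..n - 2} E}"
proof -
  have "tournament ((>) :: nat \<Rightarrow> _)" "tournament ((<) :: nat \<Rightarrow> _)"
    by (auto simp: tournament_def)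
  then show ?thesis
    unfolding primitive_G_word_eq primitive_R_word_eq using card_primitive_words assms by blast
qed

end
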